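(* For all $n_1,n_2,m\in\mathbb{N}$, $U(n_1+n_2,m)\le U(n_1,m)+U(n_2,m)$.
   Context: The sequence $(a(n))_{n\ge1}$ is defined by $a(1)=1$; $a(2^k-1+i)=2^{k-1}+a(i)$ for $1\le i\le 2^k-1$, $k\in\mathbb{N}$; and $a(2^{k+1}-1)=2^k$ for $k\in\mathbb{N}$. For $n,m\in\mathbb{N}$, let $k\ge0$ be the integer with $2^k\le m<2^{k+1}$, and let $q\ge 0$ and $1\le r\le 2^{k+1}-1$ be the integers with $n=(2^{k+1}-1)q+r$; then $U(n,m)=q2^k+a(r)$. *)

theory Defs
  imports Main
begin

lemma pow2_bracket_unique:
  fixes m :: nat
  assumes "2 ^ k \<le> m" "m < 2 ^ (k + 1)" "2 ^ l \<le> m" "m < 2 ^ (l + 1)"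
  shows "k = l"
proof -
  have "(2::nat) ^ k < 2 ^ (l + 1)" "(2::nat) ^ l < 2 ^ (k + 1)"
    using assms by linarith+
  then show ?thesis
    using power_less_imp_less_exp[of "2::nat" k "l + 1"]
      power_less_imp_less_exp[of "2::nat" l "k + 1"] by simp
qed

lemma pow2_index_bracket:
  fixes i k :: nat
  assumes "1 \<le> i" "i \<le> 2 ^ k - 1"
  shows "2 ^ k \<le> 2 ^ k - 1 + i" "2 ^ k - 1 + i < 2 ^ (k + 1) - 1"
proof -
  have "(2::nat) ^ (k + 1) = 2 * 2 ^ k" "(1::nat) \<le> 2 ^ k" by simp_all
  with assms show "2 ^ k \<le> 2 ^ k - 1 + i" "2 ^ k - 1 + i < 2 ^ (k + 1) - 1"
    by linarith+
qed

lemma pow2_pred_inj: "(2::nat) ^ k - 1 = 2 ^ l - 1 \<Longrightarrow> k = l"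
  using eq_diff_iff[of 1 "2 ^ k" "2 ^ l :: nat"] by simp

text \<open>The sequence is indexed by the positive integers; its value at 0 is a convention.\<close>

function a_seq :: "nat \<Rightarrow> nat" where
  "a_seq 0 = 0"
| "a_seq 1 = 1"
| "1 \<le> k \<Longrightarrow> 1 \<le> i \<Longrightarrow> i \<le> 2 ^ k - 1 \<Longrightarrow>
     a_seq (2 ^ k - 1 + i) = 2 ^ (k - 1) + a_seq i"
| "1 \<le> k \<Longrightarrow> a_seq (2 ^ (k + 1) - 1) = 2 ^ k"
proof goal_cases
  case (1 P x)
  show P
  proof (cases "x \<le> 1")
    case True
    then show P using 1(1,2) by (cases x) auto
  next
    case False
    then obtain k where k: "2 ^ k \<le> x" "x < 2 ^ (k + 1)"
      using ex_power_ivl1[of 2 x] by auto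
    have k1: "1 \<le> k" using k False by (cases k) auto
    show P
    proof (cases "x = 2 ^ (k + 1) - 1")
      case True
      then show P using 1(4) k1 by blast
    next
      case False
      have p: "(1::nat) \<le> 2 ^ k" by simp
      have "x = 2 ^ k - 1 + (x - (2 ^ k - 1))" using k p by linarith
      moreover have "1 \<le> x - (2 ^ k - 1)" using k p by linarith
      moreover have "x - (2 ^ k - 1) \<le> 2 ^ k - 1" using k p False by simp
      ultimately show P using 1(3) k1 by blast
    qed
  qed
next
  case (5 k)
  then show ?case using one_less_power[of "2::nat" "k + 1"] by simp
next
  case (7 k i)
  have "(2::nat) ^ 1 \<le> 2 ^ k" using 7 by (intro power_increasing) auto
  then show ?case using 7 pow2_index_bracket(1)[of i k] by simp
next
  case (8 k)
  have "(2::nat) ^ 2 \<le> 2 ^ (k + 1)" using 8 by (intro power_increasing) auto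
  then show ?case using 8 by simp
next
  case (9 k i l j)
  have "k = l"
    using pow2_index_bracket[of i k] pow2_index_bracket[of j l] 9
    by (intro pow2_bracket_unique[of k "2 ^ k - 1 + i" l]) linarith+
  then have "i = j" using 9 by simp
  then show ?case using \<open>k = l\<close> by simp
next
  case (10 k i l)
  have "(2::nat) ^ l \<le> 2 ^ (l + 1) - 1" "2 ^ (l + 1) - 1 < (2::nat) ^ (l + 1)"
    by (simp_all add: le_diff_conv2)
  then have "k = l"
    using pow2_index_bracket[of i k] 10
    by (intro pow2_bracket_unique[of k "2 ^ k - 1 + i" l]) linarith+
  then show ?case using 10 pow2_index_bracket[of i k] by simp
next
  case (11 k l)
  then show ?case using pow2_pred_inj[of "k + 1" "l + 1"] by simp
qed auto
termination
proof (relation "measure id", goal_cases)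
  case (2 k i)
  then have "(2::nat) ^ 1 \<le> 2 ^ k" by (intro power_increasing) auto
  then show ?case by simp
qed simp

text \<open>Likewise, only positive arguments of \<open>U\<close> are meaningful.\<close>

function U :: "nat \<Rightarrow> nat \<Rightarrow> nat" where
  "2 ^ k \<le> m \<Longrightarrow> m < 2 ^ (k + 1) \<Longrightarrow> 1 \<le> r \<Longrightarrow> r \<le> 2 ^ (k + 1) - 1 \<Longrightarrow>
     U ((2 ^ (k + 1) - 1) * q + r) m = q * 2 ^ k + a_seq r"
| "n = 0 \<or> m = 0 \<Longrightarrow> U n m = 0"
proof goal_cases
  case (1 P x)
  obtain n m where x: "x = (n, m)" by (cases x)
  show P
  proof (cases "n = 0 \<or> m = 0")
    case True
    then show P using 1(2) x by blast
  next
    case False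
    then obtain k where k: "2 ^ k \<le> m" "m < 2 ^ (k + 1)"
      using ex_power_ivl1[of 2 m] by auto
    define M :: nat where "M = 2 ^ (k + 1) - 1"
    have M: "0 < M" using one_less_power[of "2::nat" "k + 1"] by (simp add: M_def)
    have "n = M * ((n - 1) div M) + ((n - 1) mod M + 1)"
      using False mult_div_mod_eq[of M "n - 1"] by linarith
    moreover have "(n - 1) mod M + 1 \<le> M"
      using mod_less_divisor[OF M, of "n - 1"] by linarith
    ultimately show P
      using 1(1)[OF k, of "(n - 1) mod M + 1" "(n - 1) div M"] x by (simp add: M_def)
  qed
next
  case (2 k m r q l m' s p)
  then have m: "m' = m" and kl: "k = l"
    using pow2_bracket_unique[of k m l] by auto
  define M :: nat where "M = 2 ^ (k + 1) - 1"
  have M: "0 < M" using one_less_power[of "2::nat" "k + 1"] by (simp add: M_def)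
  have eq: "M * q + (r - 1) = M * p + (s - 1)" and r: "r - 1 < M" and s: "s - 1 < M"
    using 2 kl M unfolding M_def by auto
  have "q = p" "r - 1 = s - 1"
    using arg_cong[OF eq, of "\<lambda>t. t div M"] arg_cong[OF eq, of "\<lambda>t. t mod M"] r s M
    by simp_all
  then show ?case using kl 2 by simp
qed auto
termination by (relation "{}") auto

end

theory Submission
  imports Defs
begin

text \<open>
  Consider coins of sizes \<open>c\<^sub>j = 2 ^ (j + 1) - 1\<close> for \<open>j \<le> k\<close> and give the coin of size \<open>c\<^sub>j\<close> the
  value \<open>2 ^ j = (c\<^sub>j + 1) / 2\<close>. If \<open>2 ^ k \<le> m < 2 ^ (k + 1)\<close>, then \<open>U n m\<close> is the value of the greedy
  change of \<open>n\<close>. Any change of \<open>n\<close> by \<open>N\<close> coins has value \<open>(n + N) / 2\<close>, and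
  \<open>c\<^bsub>j+1\<^esub> = 2 c\<^sub>j + 1\<close> makes the greedy change use the fewest coins. A change of \<open>n\<^sub>1\<close> together with
  one of \<open>n\<^sub>2\<close> is a change of \<open>n\<^sub>1 + n\<^sub>2\<close>, hence subadditivity. The optimality of the greedy change
  enters in the form that adding \<open>c\<^sub>j\<close> to \<open>n\<close> raises the greedy value by at most \<open>2 ^ j\<close>.
\<close>

definition coin :: "nat \<Rightarrow> nat" where
  "coin j = 2 ^ (j + 1) - 1"

fun greedy_value :: "nat \<Rightarrow> nat \<Rightarrow> nat" where
  "greedy_value 0 n = n"
| "greedy_value (Suc k) n =
     (n div coin (Suc k)) * 2 ^ Suc k + greedy_value k (n mod coin (Suc k))"

lemma coin_0 [simp]: "coin 0 = 1"
  by (simp add: coin_def)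

lemma coin_Suc: "coin (Suc j) = 2 * coin j + 1"
proof -
  have "(1::nat) \<le> 2 ^ j" "(2::nat) ^ (Suc j + 1) = 4 * 2 ^ j" "(2::nat) ^ (j + 1) = 2 * 2 ^ j"
    by simp_all
  then show ?thesis unfolding coin_def by linarith
qed

lemma coin_pos [simp]: "0 < coin j"
  by (induction j) (simp_all add: coin_Suc)

lemma coin_mono: "i \<le> j \<Longrightarrow> coin i \<le> coin j"
  by (rule lift_Suc_mono_le[of coin]) (simp_all add: coin_Suc)

lemma greedy_value_0_right [simp]: "greedy_value k 0 = 0"
  by (induction k) simp_all

lemma greedy_value_add_mult_coin:
  "greedy_value k (n + q * coin k) = greedy_value k n + q * 2 ^ k"
  by (cases k) (simp_all add: distrib_right)

lemma greedy_value_add_coin: "greedy_value k (n + coin k) = greedy_value k n + 2 ^ k"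
  using greedy_value_add_mult_coin[of k n 1] by simp

lemma greedy_value_coin [simp]: "greedy_value k (coin k) = 2 ^ k"
  using greedy_value_add_coin[of k 0] by simp

lemma greedy_value_Suc_less: "n < coin (Suc k) \<Longrightarrow> greedy_value (Suc k) n = greedy_value k n"
  by simp

text \<open>Basis of the exchange argument: two coins of index \<open>k\<close> are worth one of
  index \<open>Suc k\<close>, although their total size is one less.\<close>

lemma greedy_value_double_coin: "greedy_value k (s + 2 * coin k) = greedy_value k s + 2 ^ Suc k"
  using greedy_value_add_mult_coin[of k s 2] by simp

lemma greedy_value_le_Suc: "greedy_value k n \<le> greedy_value k (Suc n)"
proof (induction k arbitrary: n)
  case 0
  show ?case by simp
next
  case (Suc k)
  let ?c = "coin (Suc k)"
  define q r where "q = n div ?c" and "r = n mod ?c"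
  have n: "n = r + q * ?c" and r: "r < ?c"
    by (simp_all add: q_def r_def)
  have "greedy_value (Suc k) r \<le> greedy_value (Suc k) (Suc r)"
  proof (cases "Suc r < ?c")
    case True
    then show ?thesis using Suc.IH[of r] by simp
  next
    case False
    with r have rc: "Suc r = ?c" by simp
    \<comment> \<open>The only remainder at which adding 1 completes a new coin; there the value
      stays the same.\<close>
    then have "r = 0 + 2 * coin k" by (simp add: coin_Suc)
    then have "greedy_value k r = 2 ^ Suc k"
      using greedy_value_double_coin[of k 0] by simp
    then show ?thesis
      unfolding rc greedy_value_coin greedy_value_Suc_less[OF r] by simp
  qed
  then show ?case
    using greedy_value_add_mult_coin[of "Suc k" r q] greedy_value_add_mult_coin[of "Suc k" "Suc r" q]
    by (simp add: n del: greedy_value.simps)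
qed

text \<open>Only a carry into a coin of index \<open>Suc k\<close> needs an argument: replacing that
  coin by two of index \<open>k\<close> frees one unit, which monotonicity absorbs.\<close>

lemma greedy_value_add_smaller_coin:
  "j \<le> k \<Longrightarrow> greedy_value k (n + coin j) \<le> greedy_value k n + 2 ^ j"
proof (induction k arbitrary: n)
  case 0
  then show ?case by simp
next
  case (Suc k)
  show ?case
  proof (cases "j = Suc k")
    case True
    then show ?thesis by (simp add: greedy_value_add_coin del: greedy_value.simps)
  next
    case False
    with Suc.prems have jk: "j \<le> k" by simp
    let ?c = "coin (Suc k)"
    define q r where "q = n div ?c" and "r = n mod ?c"
    have n: "n = r + q * ?c" and r: "r < ?c"
      by (simp_all add: q_def r_def)
    have IH: "greedy_value k (r + coin j) \<le> greedy_value k r + 2 ^ j"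
      by (rule Suc.IH[OF jk])
    have "greedy_value (Suc k) (r + coin j) \<le> greedy_value k (r + coin j)"
    proof (cases "r + coin j < ?c")
      case True
      then show ?thesis by simp
    next
      case False
      define s where "s = r + coin j - ?c"
      have s: "r + coin j = s + ?c"
        using False by (simp add: s_def)
      \<comment> \<open>At most one carry occurs, as \<open>r < ?c\<close> and
        \<open>coin j \<le> ?c\<close>.\<close>
      have "s < ?c"
        using s r coin_mono[OF Suc.prems] by linarith
      then have "greedy_value (Suc k) (r + coin j) = greedy_value k s + 2 ^ Suc k"
        unfolding s greedy_value_add_coin by (simp only: greedy_value_Suc_less)
      also have "\<dots> \<le> greedy_value k (Suc s) + 2 ^ Suc k"
        using greedy_value_le_Suc by simp
      also have "\<dots> = greedy_value k (Suc s + 2 * coin k)"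
        by (rule greedy_value_double_coin[symmetric])
      also have "Suc s + 2 * coin k = r + coin j"
        using s by (simp add: coin_Suc)
      finally show ?thesis .
    qed
    with IH r have "greedy_value (Suc k) (r + coin j) \<le> greedy_value (Suc k) r + 2 ^ j"
      by (simp only: greedy_value_Suc_less)
    moreover have "n + coin j = r + coin j + q * ?c"
      using n by simp
    ultimately show ?thesis
      using n by (simp only: greedy_value_add_mult_coin)
  qed
qed

lemma greedy_value_add_mult_smaller_coin:
  assumes "j \<le> k"
  shows "greedy_value k (n + q * coin j) \<le> greedy_value k n + q * 2 ^ j"
proof (induction q)
  case (Suc q)
  then show ?case
    using greedy_value_add_smaller_coin[OF assms, of "n + q * coin j"] by (simp add: ac_simps)
qed simp

text \<open>The coins of the greedy change of \<open>x\<close> are added to \<open>n\<close> one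
  size at a time. Keeping \<open>j\<close> apart from \<open>k\<close> lets the induction run over
  the sizes used for \<open>x\<close> while \<open>k\<close> stays fixed.\<close>

lemma greedy_value_add_le:
  "j \<le> k \<Longrightarrow> greedy_value k (n + x) \<le> greedy_value k n + greedy_value j x"
proof (induction j arbitrary: n x)
  case 0
  then show ?case using greedy_value_add_mult_smaller_coin[of 0 k n x] by simp
next
  case (Suc j)
  let ?c = "coin (Suc j)"
  have "greedy_value k (n + x) = greedy_value k (n + x mod ?c + (x div ?c) * ?c)"
    by (simp add: ac_simps)
  also have "\<dots> \<le> greedy_value k (n + x mod ?c) + (x div ?c) * 2 ^ Suc j"
    by (rule greedy_value_add_mult_smaller_coin[OF Suc.prems])
  also have "\<dots> \<le> greedy_value k n + greedy_value j (x mod ?c) + (x div ?c) * 2 ^ Suc j"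
    using Suc.IH[of n "x mod ?c"] Suc.prems by simp
  finally show ?case by simp
qed

text \<open>Strictly between \<open>coin k\<close> and \<open>coin (Suc k)\<close>, the recursion of
  \<open>a_seq\<close> removes one coin of index \<open>k\<close>, just as the greedy change may; at
  \<open>coin (Suc k)\<close> both give a single coin.\<close>

lemma a_seq_eq_greedy_value: "n \<le> coin k \<Longrightarrow> a_seq n = greedy_value k n"
proof (induction k arbitrary: n)
  case 0
  then have "n = 0 \<or> n = 1" by auto
  then show ?case using a_seq.simps(1,2) by auto
next
  case (Suc k)
  consider "n = coin (Suc k)" | "n \<le> coin k" | "coin k < n" "n < coin (Suc k)"
    using Suc.prems by linarith
  then show ?case
  proof cases
    case 1
    then show ?thesis
      using a_seq.simps(4)[of "Suc k"] greedy_value_coin[of "Suc k"]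
      by (simp add: coin_def del: greedy_value.simps)
  next
    case 2
    then have "n < coin (Suc k)" by (simp add: coin_Suc)
    with 2 show ?thesis using Suc.IH by simp
  next
    case 3
    define i where "i = n - coin k"
    have n: "n = coin k + i" and i: "1 \<le> i" "i \<le> coin k"
      using 3 by (simp_all add: i_def coin_Suc)
    have "a_seq n = 2 ^ k + a_seq i"
      using a_seq.simps(3)[of "Suc k" i] i by (simp add: n coin_def)
    also have "\<dots> = greedy_value k (i + coin k)"
      using Suc.IH[OF i(2)] by (simp add: greedy_value_add_coin)
    also have "i + coin k = n" using n by simp
    finally show ?thesis
      using greedy_value_Suc_less[OF 3(2)] by simp
  qed
qed

lemma U_eq_greedy_value:
  assumes "2 ^ k \<le> m" "m < 2 ^ (k + 1)"
  shows "U n m = greedy_value k n"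
proof (cases "n = 0")
  case False
  \<comment> \<open>\<open>U\<close> takes remainders from 1 to \<open>coin k\<close>, hence the
    shift by one. A remainder \<open>coin k\<close> counts as one more full coin in the greedy
    value.\<close>
  define q r where "q = (n - 1) div coin k" and "r = (n - 1) mod coin k + 1"
  have n: "n = coin k * q + r"
    using False mult_div_mod_eq[of "coin k" "n - 1"] unfolding q_def r_def by linarith
  have r: "1 \<le> r" "r \<le> coin k"
    by (simp_all add: r_def Suc_leI)
  have "U n m = q * 2 ^ k + a_seq r"
    using U.simps(1)[OF assms r(1) r(2)[unfolded coin_def]] by (simp add: n coin_def)
  also have "\<dots> = greedy_value k (r + q * coin k)"
    by (simp add: a_seq_eq_greedy_value[OF r(2)] greedy_value_add_mult_coin)
  also have "r + q * coin k = n" using n by simp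
  finally show ?thesis .
qed simp

theorem theorem4p2:
  fixes n\<^sub>1 n\<^sub>2 m :: nat
  assumes "1 \<le> n\<^sub>1" and "1 \<le> n\<^sub>2" and "1 \<le> m"
  shows "U (n\<^sub>1 + n\<^sub>2) m \<le> U n\<^sub>1 m + U n\<^sub>2 m"
proof -
  obtain k where "2 ^ k \<le> m" "m < 2 ^ (k + 1)"
    using ex_power_ivl1[of 2 m] assms(3) by auto
  then show ?thesis
    using greedy_value_add_le[of k k n\<^sub>1 n\<^sub>2] by (simp only: U_eq_greedy_value)
qed

end
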